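(* For $c\in[-2,2]$ consider the conformal univalent map of the unit disk $\mathbb{D}$ onto a domain convex in the direction of the real axis given by $$F_c(z)=\frac{z}{1+cz+z^2},$$ and let the dilatation be $\omega_a(z)=\dfrac{z(z+a)}{1+az}$, where $-1\le a\le 1$. (1) For $c\in(-2,2)$ and $-1\le a\le 1$, the horizontal shear of $F_c$ with dilatation $\omega_a$ is given by the two-parameter family of harmonic mappings $f_{c,a}=h_{c,a}+\overline{g_{c,a}}$, where $$h_{c,a}(z)=-\frac{p(z)}{q(z)},\qquad g_{c,a}(z)=-\frac{r(z)}{q(z)},\qquad q(z)=(c^2-4)\,\sigma_3\sigma_4\,(1+cz+z^2),$$ $$p(z)=(\sigma_1+\sigma_2)K(z)+\sigma_3\sigma_4\left(2z+2az^2-cz^2-c^2z+acz\right),$$ $$r(z)=(\sigma_1+\sigma_2)K(z)+\sigma_3\sigma_4\left(-2z+2az^2-cz^2+acz\right),$$ $$K(z)=16-4c^2+16z^2-4c^2z^2+2ac^3-4c^3z-8ac+16cz+2ac^3z^2-8acz^2-8ac^2z+2ac^4z,$$ $$\sigma_1=\operatorname{atanh}\left(\frac{(c^2-4)(c+2z)}{\sigma_3\sigma_4}\right),\quad \sigma_2=\operatorname{atanh}\left(\frac{4c-c^3}{\sigma_3\sigma_4}\right),\quad \sigma_3=(c-2)^{3/2},\quad \sigma_4=(c+2)^{3/2},$$ and $f_{c,a}\in S_H^0$. (2) For the special case $c=-2$ with $-1\le a\le 1$, the shear is $$f_{-2,a}(z)=\operatorname{Re}\left\{\frac a3-\frac{z^2+(a-1)z-\frac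 a3+\frac23}{(z-1)^3}-\frac23\right\}+\frac{i}{4}\operatorname{Im}\left\{\left(\frac{1+z}{1-z}\right)^2-1\right\}.$$ (3) For the special case $c=2$ with $-1\le a\le 1$, the shear is $$f_{2,a}(z)=\operatorname{Re}\left\{\frac a3-\frac{z^2+(a+1)z+\frac a3+\frac23}{(z+1)^3}+\frac23\right\}+i\operatorname{Im}\left\{\frac{z}{(1+z)^2}\right\}.$$ (4) Additionally, for $-1\le a\le 1$, the image of $\mathbb{D}$ is a slit domain: $f_{-2,a}(\mathbb{D})$ is a slit domain where the tip of the slit is located at $-(2-a)/6$, and $f_{2,a}(\mathbb{D})$ is a slit domain where the tip of the slit is located at $(a+2)/6$. Moreover $f_{-2,a},f_{2,a}\in S_H^0$.
   Context: $\mathbb{D}=\{z\in\mathbb{C}:|z|<1\}$. A domain is convex in the direction of the real axis (equivalently, convex in the horizontal direction) if its intersection with every line parallel to the real axis is connected. $S_H^0$ is the family of harmonic univalent mappings $f:\mathbb{D}\to\mathbb{C}$ of the form $f=h+\overline g$ with $h,g$ analytic on $\mathbb{D}$ and $h(0)=g(0)=0$, $h'(0)=1$, $g'(0)=0$. The dilatation of $f=h+\overline g$ is $\omega=g'/h'$. Given an analytic univalent $F$ on $\mathbb{D}$ with $F(0)=0$ and an analytic $\omega:\mathbb{D}\to\mathbb{D}$, the horizontal shear of $F$ with dilatation $\omega$ is the harmonic mapping $f=h+\overline g=\operatorname{Re}(h+g)+i\operatorname{Im}(h-g)$, where $h,g$ are the analytic functions on $\mathbb{D}$ with $h-g=F$,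 $g'=\omega h'$, $h(0)=g(0)=0$. For $a=1$, $a=-1$ and $a=0$, $\omega_a(z)$ is $z$, $-z$ and $z^2$ respectively. Powers $(\cdot)^{3/2}$ and $\operatorname{atanh}$ are principal branches. A slit domain is the entire complex plane minus a half-line (the slit) of the real axis, and the tip is the endpoint of that half-line; for $c=-2$ the slit lies along the negative real axis, and for $c=2$ along the positive real axis.
   Formalization: In (4) the slit-domain claim is stated only for -1<a≤1 when c=-2 and -1≤a<1 when c=2: f_{-2,-1} maps the disk onto the half-plane Re w>-1/2 and f_{2,1} onto Re w<1/2, which are not slit domains. *)

theory Defs
  imports "HOL-Complex_Analysis.Complex_Analysis"
begin

abbreviation unit_disk :: "complex set" (\<open>\<bbbD>\<close>) where
  "\<bbbD> \<equiv> ball 0 1"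

definition univalent :: "(complex \<Rightarrow> complex) \<Rightarrow> bool" where
  "univalent F \<longleftrightarrow> F holomorphic_on \<bbbD> \<and> inj_on F \<bbbD>"

definition horizontally_convex_domain :: "complex set \<Rightarrow> bool" where
  "horizontally_convex_domain D \<longleftrightarrow>
     open D \<and> connected D \<and> D \<noteq> {} \<and> (\<forall>y. connected (D \<inter> {z. Im z = y}))"

text \<open>
  Mappings are total functions of which only the values on the disk matter. Harmonicity of a
  member of the class is the decomposition into an analytic and a conjugate analytic part.
\<close>
definition SH0 :: "(complex \<Rightarrow> complex) set" where
  "SH0 = {f. inj_on f \<bbbD> \<and>
     (\<exists>h g. h holomorphic_on \<bbbD> \<and> g holomorphic_on \<bbbD> \<and> (\<forall>z\<in>\<bbbD>. f z = h z + cnj (g z)) \<and>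
        h 0 = 0 \<and> g 0 = 0 \<and> deriv h 0 = 1 \<and> deriv g 0 = 0)}"

text \<open>
  The pair \<open>(h, g)\<close> of the horizontal shear of \<open>F\<close> with dilatation \<open>\<omega>\<close>. The conditions on
  \<open>F\<close> and \<open>\<omega>\<close> under which a shear is defined are part of the predicate.
\<close>
definition horizontal_shear_parts ::
    "(complex \<Rightarrow> complex) \<Rightarrow> (complex \<Rightarrow> complex) \<Rightarrow> (complex \<Rightarrow> complex) \<Rightarrow> (complex \<Rightarrow> complex) \<Rightarrow> bool"
where
  "horizontal_shear_parts F \<omega> h g \<longleftrightarrow>
     univalent F \<and> F 0 = 0 \<and> \<omega> holomorphic_on \<bbbD> \<and> \<omega> ` \<bbbD> \<subseteq> \<bbbD> \<and>
     h holomorphic_on \<bbbD> \<and> g holomorphic_on \<bbbD> \<and> h 0 = 0 \<and> g 0 = 0 \<and>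
     (\<forall>z\<in>\<bbbD>. h z - g z = F z) \<and> (\<forall>z\<in>\<bbbD>. deriv g z = \<omega> z * deriv h z)"

definition horizontal_shear ::
    "(complex \<Rightarrow> complex) \<Rightarrow> (complex \<Rightarrow> complex) \<Rightarrow> (complex \<Rightarrow> complex) \<Rightarrow> bool"
where
  "horizontal_shear F \<omega> f \<longleftrightarrow>
     (\<exists>h g. horizontal_shear_parts F \<omega> h g \<and> (\<forall>z\<in>\<bbbD>. f z = h z + cnj (g z)))"

definition F_map :: "real \<Rightarrow> complex \<Rightarrow> complex" where
  "F_map c z = z / (1 + of_real c * z + z\<^sup>2)"

definition dilat :: "real \<Rightarrow> complex \<Rightarrow> complex" where
  "dilat a z = z * (z + of_real a) / (1 + of_real a * z)"

text \<open>
  Complex \<open>powr\<close> uses the principal logarithm, so \<open>\<sigma>3 c\<close> is purely imaginary for \<open>c < 2\<close>.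
  Complex \<open>artanh w\<close> is half the principal logarithm of \<open>(1 + w) / (1 - w)\<close>, which is the
  principal branch on the plane cut along the real \<open>w\<close> with \<open>\<bar>w\<bar> \<ge> 1\<close>; for \<open>-2 < c < 2\<close> the
  arguments below avoid the cuts.
\<close>
definition \<sigma>3 :: "real \<Rightarrow> complex" where
  "\<sigma>3 c = complex_of_real (c - 2) powr (3/2)"

definition \<sigma>4 :: "real \<Rightarrow> complex" where
  "\<sigma>4 c = complex_of_real (c + 2) powr (3/2)"

definition \<sigma>1 :: "real \<Rightarrow> complex \<Rightarrow> complex" where
  "\<sigma>1 c z = artanh ((of_real c ^ 2 - 4) * (of_real c + 2 * z) / (\<sigma>3 c * \<sigma>4 c))"

definition \<sigma>2 :: "real \<Rightarrow> complex" where
  "\<sigma>2 c = artanh ((4 * of_real c - of_real c ^ 3) / (\<sigma>3 c * \<sigma>4 c))"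

definition K_poly :: "real \<Rightarrow> real \<Rightarrow> complex \<Rightarrow> complex" where
  "K_poly c' a' z = (let c = complex_of_real c'; a = complex_of_real a' in
     16 - 4 * c^2 + 16 * z^2 - 4 * c^2 * z^2 + 2 * a * c^3 - 4 * c^3 * z - 8 * a * c + 16 * c * z
     + 2 * a * c^3 * z^2 - 8 * a * c * z^2 - 8 * a * c^2 * z + 2 * a * c^4 * z)"

definition p_fun :: "real \<Rightarrow> real \<Rightarrow> complex \<Rightarrow> complex" where
  "p_fun c' a' z = (let c = complex_of_real c'; a = complex_of_real a' in
     (\<sigma>1 c' z + \<sigma>2 c') * K_poly c' a' z
     + \<sigma>3 c' * \<sigma>4 c' * (2 * z + 2 * a * z^2 - c * z^2 - c^2 * z + a * c * z))"

definition r_fun :: "real \<Rightarrow> real \<Rightarrow> complex \<Rightarrow> complex" where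
  "r_fun c' a' z = (let c = complex_of_real c'; a = complex_of_real a' in
     (\<sigma>1 c' z + \<sigma>2 c') * K_poly c' a' z
     + \<sigma>3 c' * \<sigma>4 c' * (- 2 * z + 2 * a * z^2 - c * z^2 + a * c * z))"

definition q_fun :: "real \<Rightarrow> complex \<Rightarrow> complex" where
  "q_fun c' z = (let c = complex_of_real c' in
     (c^2 - 4) * \<sigma>3 c' * \<sigma>4 c' * (1 + c * z + z^2))"

definition h_fun :: "real \<Rightarrow> real \<Rightarrow> complex \<Rightarrow> complex" where
  "h_fun c a z = - (p_fun c a z / q_fun c z)"

definition g_fun :: "real \<Rightarrow> real \<Rightarrow> complex \<Rightarrow> complex" where
  "g_fun c a z = - (r_fun c a z / q_fun c z)"

definition f_fun :: "real \<Rightarrow> real \<Rightarrow> complex \<Rightarrow> complex" where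
  "f_fun c a z = h_fun c a z + cnj (g_fun c a z)"

definition f_minus2 :: "real \<Rightarrow> complex \<Rightarrow> complex" where
  "f_minus2 a' z = (let a = complex_of_real a' in
     of_real (Re (a/3 - (z^2 + (a - 1) * z - a/3 + 2/3) / (z - 1)^3 - 2/3))
     + \<i> / 4 * of_real (Im (((1 + z) / (1 - z))^2 - 1)))"

definition f_plus2 :: "real \<Rightarrow> complex \<Rightarrow> complex" where
  "f_plus2 a' z = (let a = complex_of_real a' in
     of_real (Re (a/3 - (z^2 + (a + 1) * z + a/3 + 2/3) / (z + 1)^3 + 2/3))
     + \<i> * of_real (Im (z / (1 + z)^2)))"

definition left_slit_domain :: "real \<Rightarrow> complex set" where
  "left_slit_domain t = UNIV - complex_of_real ` {..t}"

definition right_slit_domain :: "real \<Rightarrow> complex set" where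
  "right_slit_domain t = UNIV - complex_of_real ` {t..}"

text \<open>
  The image of the disk is a slit domain except in two boundary cases: \<open>f_minus2 (-1)\<close> maps the
  disk into the half-plane \<open>Re w > -1/2\<close> and \<open>f_plus2 1\<close> into \<open>Re w < 1/2\<close>, so neither image is
  a slit domain.
\<close>

lemma Re_f_minus2_gt:
  assumes "z \<in> \<bbbD>"
  shows "Re (f_minus2 (-1) z) > - 1/2"
proof -
  have z: "norm z < 1" using assms by simp
  hence z1: "z - 1 \<noteq> 0" by auto
  have "z^2 + (-1 - 1) * z - (-1)/3 + 2/3 = (z - 1)^2"
    by (simp add: power2_eq_square algebra_simps)
  moreover have "(z - 1)^2 / (z - 1)^3 = 1 / (z - 1)"
    using z1 by (simp add: power2_eq_square power3_eq_cube)
  ultimately have "Re (f_minus2 (-1) z) = - 1 - Re (1 / (z - 1))"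
    by (simp add: f_minus2_def Let_def)
  moreover have n: "(Re z)\<^sup>2 + (Im z)\<^sup>2 < 1"
    using z cmod_power2[of z] power_strict_mono[of "cmod z" 1 2] by simp
  moreover have "Re (1 / (z - 1)) = (Re z - 1) / ((Re z - 1)\<^sup>2 + (Im z)\<^sup>2)"
    by (simp add: Re_divide)
  moreover have pos: "(Re z - 1)\<^sup>2 + (Im z)\<^sup>2 > 0"
    using z1 by (metis cmod_power2 complex.sel(1,2) minus_complex.simps one_complex.simps
        diff_zero zero_less_norm_iff zero_less_power)
  moreover have "(Re z - 1) / ((Re z - 1)\<^sup>2 + (Im z)\<^sup>2) < - 1/2"
    unfolding pos_divide_less_eq[OF pos] using n by (simp add: power2_diff field_simps)
  ultimately show ?thesis by linarith
qed

lemma f_minus2_image_not_slit: "f_minus2 (-1) ` \<bbbD> \<notin> range left_slit_domain \<union> range right_slit_domain"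
proof
  assume "f_minus2 (-1) ` \<bbbD> \<in> range left_slit_domain \<union> range right_slit_domain"
  then obtain t where "f_minus2 (-1) ` \<bbbD> \<in> {left_slit_domain t, right_slit_domain t}" by blast
  moreover have "\<i> - 1 \<in> left_slit_domain t" "\<i> - 1 \<in> right_slit_domain t"
    by (auto simp: left_slit_domain_def right_slit_domain_def complex_eq_iff)
  ultimately have "\<i> - 1 \<in> f_minus2 (-1) ` \<bbbD>" by blast
  then obtain z where "z \<in> \<bbbD>" "\<i> - 1 = f_minus2 (-1) z" by blast
  with Re_f_minus2_gt[of z] have "Re (\<i> - 1) > - 1/2" by metis
  thus False by simp
qed

lemma f_plus2_eq: "f_plus2 1 z = - f_minus2 (-1) (- z)"
proof -
  have cube: "(- z - 1)^3 = - ((z + 1)^3)" by (simp add: power3_eq_cube algebra_simps)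
  have "((1 - z) / (1 + z))\<^sup>2 - 1 = - (4 * (z / (1 + z)\<^sup>2))" if "1 + z \<noteq> 0"
  proof -
    have "((1 - z) / (1 + z))\<^sup>2 - 1 = ((1 - z)\<^sup>2 - (1 + z)\<^sup>2) / (1 + z)\<^sup>2"
      using that by (subst power_divide, subst diff_divide_distrib) simp
    also have "(1 - z)\<^sup>2 - (1 + z)\<^sup>2 = - (4 * z)"
      by (simp add: power2_eq_square algebra_simps)
    finally show ?thesis by simp
  qed
  moreover have "Im (- (4 * w)) = - (4 * Im w)" for w by simp
  ultimately have "Im (((1 - z) / (1 + z))\<^sup>2 - 1) = - (4 * Im (z / (1 + z)\<^sup>2))"
    by (cases "1 + z = 0") (simp, metis)
  thus ?thesis
    by (simp add: f_plus2_def f_minus2_def Let_def cube complex_eq_iff)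
qed

lemma f_plus2_image_not_slit: "f_plus2 1 ` \<bbbD> \<notin> range left_slit_domain \<union> range right_slit_domain"
proof
  assume "f_plus2 1 ` \<bbbD> \<in> range left_slit_domain \<union> range right_slit_domain"
  then obtain t where "f_plus2 1 ` \<bbbD> \<in> {left_slit_domain t, right_slit_domain t}" by blast
  moreover have "\<i> + 1 \<in> left_slit_domain t" "\<i> + 1 \<in> right_slit_domain t"
    by (auto simp: left_slit_domain_def right_slit_domain_def complex_eq_iff)
  ultimately have "\<i> + 1 \<in> f_plus2 1 ` \<bbbD>" by blast
  then obtain z where z: "z \<in> \<bbbD>" "\<i> + 1 = f_plus2 1 z" by blast
  hence "Re (\<i> + 1) = - Re (f_minus2 (-1) (- z))"
    by (simp only: f_plus2_eq uminus_complex.simps)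
  thus False using Re_f_minus2_gt[of "- z"] z(1) by simp
qed

end

theory Submission
  imports Defs "HOL-Real_Asymp.Real_Asymp"
begin

text \<open>
  Write \<open>Q = 1 + c z + z\<^sup>2\<close>. The shear of \<open>F_map c\<close> with dilatation \<open>dilat a\<close> is characterised by
  \<open>h' = F' / (1 - \<omega>) = (1 + a z) / Q\<^sup>2\<close>, so each formula for \<open>h\<close> is checked by differentiation; for
  \<open>-2 < c < 2\<close> the inverse hyperbolic tangents are arctangents of \<open>(c + 2 z) / sqrt (4 - c\<^sup>2)\<close>. Since
  \<open>f = F + 2 Re g\<close>, the map \<open>f \<circ> F\<inverse>\<close> preserves horizontal lines and is increasing on each of
  them, which gives univalence. For \<open>c = -2\<close> the Cayley transform \<open>\<zeta> = (1 + z) / (1 - z) = x + i y\<close> turns the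
  shear into \<open>-(2 - a)/6 + Re ((1 + a) \<zeta>\<^sup>3 / 12 + (1 - a) \<zeta> / 4) + i x y / 2\<close> on \<open>x > 0\<close>, so that on the line
  of height \<open>v = x y / 2\<close> the real part is an explicit function of \<open>x\<close>, whose range is found by
  the intermediate value theorem; \<open>c = 2\<close> follows by the symmetry \<open>z \<mapsto> -z\<close>.
\<close>

section \<open>The maps \<open>F_map c\<close>: univalence and image of the disk\<close>

text \<open>Writing \<open>c = - 2 * cos t\<close> factors the quadratic, with roots
  \<open>cis t\<close> and \<open>cis (- t)\<close> on the unit circle.\<close>

lemma F_map_denominator_nonzero:
  assumes "c \<in> {-2..2}" "z \<in> \<bbbD>"
  shows "1 + of_real c * z + z\<^sup>2 \<noteq> 0"
proof -
  define t where "t = arccos (- c / 2)"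
  have t: "cos t = - c / 2"
    unfolding t_def using assms(1) by (intro cos_arccos) auto
  have "(z - cis t) * (z - cis (- t)) = z\<^sup>2 - (cis t + cis (- t)) * z + cis t * cis (- t)"
    by (simp add: algebra_simps power2_eq_square)
  also have "cis t + cis (- t) = - of_real c"
    by (simp add: complex_eq_iff t)
  also have "cis t * cis (- t) = 1"
    by (simp add: cis_mult)
  finally have "1 + of_real c * z + z\<^sup>2 = (z - cis t) * (z - cis (- t))"
    by (simp add: algebra_simps)
  moreover have "z \<noteq> cis s" for s
    using assms(2) by auto
  ultimately show ?thesis
    by simp
qed

lemma has_field_derivative_F_map:
  assumes "c \<in> {-2..2}" "z \<in> \<bbbD>"
  shows "(F_map c has_field_derivative (1 - z\<^sup>2) / (1 + of_real c * z + z\<^sup>2)\<^sup>2) (at z)"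
proof -
  have "((\<lambda>z. z / (1 + of_real c * z + z\<^sup>2)) has_field_derivative
          (1 * (1 + of_real c * z + z\<^sup>2) - z * (of_real c + 2 * z)) /
          ((1 + of_real c * z + z\<^sup>2) * (1 + of_real c * z + z\<^sup>2))) (at z)"
    using F_map_denominator_nonzero[OF assms]
    by (intro DERIV_divide DERIV_ident) (auto intro!: derivative_eq_intros)
  also have "1 * (1 + of_real c * z + z\<^sup>2) - z * (of_real c + 2 * z) = 1 - z\<^sup>2"
    by (simp add: algebra_simps power2_eq_square)
  finally show ?thesis
    by (simp add: F_map_def[abs_def] power2_eq_square)
qed

lemma univalent_F_map:
  assumes c: "c \<in> {-2..2}"
  shows "univalent (F_map c)"
  unfolding univalent_def
proof
  show "F_map c holomorphic_on \<bbbD>"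
    unfolding holomorphic_on_open[OF open_ball] using has_field_derivative_F_map[OF c] by blast
  show "inj_on (F_map c) \<bbbD>"
  proof (rule inj_onI)
    fix z w assume z: "z \<in> \<bbbD>" and w: "w \<in> \<bbbD>" and eq: "F_map c z = F_map c w"
    have "z * (1 + of_real c * w + w\<^sup>2) = w * (1 + of_real c * z + z\<^sup>2)"
      using eq F_map_denominator_nonzero[OF c z] F_map_denominator_nonzero[OF c w]
      by (simp add: F_map_def frac_eq_eq)
    \<comment> \<open>Preimages come in pairs \<open>z\<close>, \<open>1 / z\<close>, of which at
      most one lies in the disk.\<close>
    hence "(z - w) * (1 - z * w) = 0"
      by (simp add: algebra_simps power2_eq_square)
    moreover have "norm (z * w) < 1"
      using z w mult_strict_mono[of "norm z" 1 "norm w" 1] by (simp add: norm_mult)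
    hence "1 - z * w \<noteq> 0"
      by auto
    ultimately show "z = w"
      by simp
  qed
qed

text \<open>Real coefficients make \<open>F_map c\<close> commute with conjugation, so by
  injectivity a real value is taken only at a point fixed by conjugation.\<close>

lemma F_map_real_imp_real:
  assumes c: "c \<in> {-2..2}" and z: "z \<in> \<bbbD>" and real: "Im (F_map c z) = 0"
  shows "Im z = 0"
proof -
  have "cnj (F_map c z) = F_map c z"
    using real by (simp add: complex_eq_iff)
  moreover have "cnj (F_map c z) = F_map c (cnj z)"
    by (simp add: F_map_def)
  moreover have "cnj z \<in> \<bbbD>"
    using z by simp
  ultimately have "cnj z = z"
    using univalent_F_map[OF c] z by (simp add: univalent_def inj_on_def)
  thus ?thesis
    by (simp add: complex_eq_iff)
qed

text \<open>Since \<open>1 / F_map c z = z + 1 / z + c\<close>, the omitted set consists of the reciprocals of the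
  points of \<open>[c - 2, c + 2]\<close>.\<close>
lemma F_map_image:
  assumes c: "c \<in> {-2..2}"
  shows "F_map c ` \<bbbD> = {w. Im w \<noteq> 0 \<or> (c + 2) * Re w < 1 \<and> (c - 2) * Re w < 1}" (is "_ = ?\<Omega>")
proof (intro equalityI subsetI)
  fix w assume "w \<in> F_map c ` \<bbbD>"
  then obtain z where z: "z \<in> \<bbbD>" and w: "w = F_map c z"
    by blast
  show "w \<in> ?\<Omega>"
  proof (cases "Im w = 0")
    case True
    hence "Im z = 0"
      using F_map_real_imp_real[OF c z] w by simp
    then obtain x where x: "z = of_real x"
      by (metis complex_is_Real_iff of_real_Re)
    have x1: "- 1 < x" "x < 1"
      using z x by auto
    hence "(1 - x)\<^sup>2 > 0" "(1 + x)\<^sup>2 > 0"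
      by simp_all
    \<comment> \<open>The differences of the two sides are \<open>(1 - x)^2\<close> and
      \<open>(1 + x)^2\<close>. Depending on the sign of \<open>x\<close>, one of the lower bounds
      is nonnegative.\<close>
    hence pos: "(1 + c * x + x\<^sup>2) > (c + 2) * x" "(1 + c * x + x\<^sup>2) > (c - 2) * x"
      by (simp_all add: algebra_simps power2_eq_square)
    have "0 < 1 + c * x + x\<^sup>2"
    proof (cases "x \<ge> 0")
      case True
      hence "(c + 2) * x \<ge> 0" using c by simp
      thus ?thesis using pos by linarith
    next
      case False
      hence "(c - 2) * x \<ge> 0" using c by (simp add: mult_nonpos_nonpos)
      thus ?thesis using pos by linarith
    qed
    moreover have "w = of_real (x / (1 + c * x + x\<^sup>2))"
      by (simp add: w x F_map_def)
    ultimately show ?thesis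
      using pos by simp
  qed simp
next
  fix w assume w: "w \<in> ?\<Omega>"
  show "w \<in> F_map c ` \<bbbD>"
  proof (cases "w = 0")
    case True
    thus ?thesis
      by (auto simp: F_map_def intro!: image_eqI[of _ _ 0])
  next
    case False
    \<comment> \<open>\<open>F_map c y = w\<close> amounts to \<open>y + 1 / y = b\<close>, that is
      \<open>y * (b - y) = 1\<close>. The roots \<open>z\<close> and \<open>b - z\<close> have
      product 1, so one of them is in the disk unless both are on the unit circle.\<close>
    define b where "b = 1 / w - of_real c"
    define z where "z = (b + csqrt (b\<^sup>2 - 4)) / 2"
    have "2 * z - b = csqrt (b\<^sup>2 - 4)"
      by (simp add: z_def field_simps)
    hence "(2 * z - b)\<^sup>2 = b\<^sup>2 - 4"
      by simp
    moreover have "4 * (z * (b - z)) = b\<^sup>2 - (2 * z - b)\<^sup>2"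
      by (simp add: power2_eq_square algebra_simps)
    ultimately have prod: "z * (b - z) = 1"
      by simp
    have F: "F_map c y = w" if "y * (b - y) = 1" for y
    proof -
      have "y \<noteq> 0" using that by auto
      have "1 + of_real c * y + y\<^sup>2 = y / w"
        using that by (simp add: b_def algebra_simps power2_eq_square)
      thus ?thesis using \<open>y \<noteq> 0\<close> False by (simp add: F_map_def)
    qed
    \<comment> \<open>On the unit circle \<open>b - z\<close> is \<open>cnj z\<close>, so
      \<open>b = 2 * Re z\<close> and \<open>1 / w\<close> would lie in
      \<open>[c - 2, c + 2]\<close>.\<close>
    have "norm z \<noteq> 1"
    proof
      assume n: "norm z = 1"
      hence "z * cnj z = 1"
        by (simp add: complex_norm_square[symmetric])
      with prod have "b - z = cnj z"
        by (metis mult_left_cancel mult_zero_left zero_neq_one)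
      hence "b = of_real (2 * Re z)"
        by (simp add: complex_eq_iff)
      hence eq: "w * of_real (c + 2 * Re z) = 1"
        using False by (simp add: b_def field_simps)
      hence "Im w * (c + 2 * Re z) = 0" "Re w * (c + 2 * Re z) = 1"
        by (simp_all add: complex_eq_iff)
      hence "Im w = 0" and one: "Re w * (c + 2 * Re z) = 1"
        by auto
      with w have less: "(c + 2) * Re w < 1" "(c - 2) * Re w < 1"
        by auto
      have "\<bar>Re z\<bar> \<le> 1"
        using abs_Re_le_cmod[of z] n by simp
      hence "Re z * Re w \<le> \<bar>Re w\<bar>"
        using mult_right_mono[of "\<bar>Re z\<bar>" 1 "\<bar>Re w\<bar>"] by (simp flip: abs_mult)
      with less one show False
        by (auto simp: algebra_simps abs_if split: if_splits)
    qed
    then consider "norm z < 1" | "norm z > 1" by linarith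
    thus ?thesis
    proof cases
      case 1
      thus ?thesis using F[OF prod] by (auto intro!: image_eqI[of _ _ z])
    next
      case 2
      have "norm z * norm (b - z) = 1"
        using prod by (metis norm_mult norm_one)
      with 2 have "norm (b - z) < 1"
        by (smt (verit) mult_le_cancel_left1 norm_ge_zero)
      moreover have "F_map c (b - z) = w"
        by (rule F) (use prod in \<open>simp add: algebra_simps\<close>)
      ultimately show ?thesis by (auto intro!: image_eqI[of _ _ "b - z"])
    qed
  qed
qed

text \<open>Every slice off the real axis is a full line, and the real slice is cut out by two
  linear inequalities, so all slices are convex.\<close>

lemma horizontally_convex_F_map_image:
  assumes c: "c \<in> {-2..2}"
  shows "horizontally_convex_domain (F_map c ` \<bbbD>)"
  unfolding horizontally_convex_domain_def
proof (intro conjI allI)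
  have hol: "F_map c holomorphic_on \<bbbD>" and inj: "inj_on (F_map c) \<bbbD>"
    using univalent_F_map[OF c] by (simp_all add: univalent_def)
  show "open (F_map c ` \<bbbD>)"
    using open_mapping_thm3[OF hol _ inj] by simp
  show "connected (F_map c ` \<bbbD>)"
    by (intro connected_continuous_image holomorphic_on_imp_continuous_on[OF hol]) simp
  show "F_map c ` \<bbbD> \<noteq> {}"
    by simp
  fix y
  have "convex (F_map c ` \<bbbD> \<inter> {z. Im z = y})"
  proof (cases "y = 0")
    case True
    have "F_map c ` \<bbbD> \<inter> {z. Im z = y} =
            {z. Im z = 0} \<inter> {z. Re z * (c + 2) < 1} \<inter> {z. Re z * (c - 2) < 1}"
      by (auto simp: F_map_image[OF c] True algebra_simps)
    moreover have "convex {z. Re z * k < 1}" for k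
      using convex_halfspace_lt[of "complex_of_real k" 1]
      by (simp add: inner_complex_def mult.commute)
    moreover have "convex {z. Im z = 0}"
      using convex_hyperplane[of \<i> 0] by (simp add: inner_complex_def)
    ultimately show ?thesis
      by (simp add: convex_Int)
  next
    case False
    have "F_map c ` \<bbbD> \<inter> {z. Im z = y} = {z. Im z = y}"
      using False by (auto simp: F_map_image[OF c])
    thus ?thesis
      using convex_hyperplane[of \<i> y] by (simp add: inner_complex_def)
  qed
  thus "connected (F_map c ` \<bbbD> \<inter> {z. Im z = y})"
    by (rule convex_connected)
qed

section \<open>Univalence of horizontal shears\<close>

text \<open>Connected sets of reals are intervals. This lets a monotonicity argument run along the
  whole segment between two points of equal height.\<close>

lemma horizontally_convex_domain_segment:
  assumes "horizontally_convex_domain D"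
    and "Complex s y \<in> D" "Complex u y \<in> D" "s \<le> t" "t \<le> u"
  shows "Complex t y \<in> D"
proof -
  have "connected (Re ` (D \<inter> {z. Im z = y}))"
    using assms(1) unfolding horizontally_convex_domain_def
    by (intro connected_continuous_image continuous_intros) auto
  moreover have "s \<in> Re ` (D \<inter> {z. Im z = y})" "u \<in> Re ` (D \<inter> {z. Im z = y})"
    using assms(2,3) by (force intro: rev_image_eqI)+
  ultimately have "t \<in> Re ` (D \<inter> {z. Im z = y})"
    using assms(4,5) connectedD_interval by blast
  then obtain z where "z \<in> D" "Im z = y" "t = Re z"
    by blast
  thus ?thesis
    by (metis complex_surj)
qed

text \<open>\<open>w / (1 - w)\<close> is the Moebius map of the disk onto this half-plane; the
  bound becomes positivity of a derivative along horizontal lines.\<close>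

lemma Re_divide_one_minus_gt:
  assumes "norm w < 1"
  shows "Re (w / (1 - w)) > - 1 / 2"
proof -
  have "w \<noteq> 1" using assms by auto
  hence "0 < (cmod (1 - w))\<^sup>2" by simp
  hence pos: "(1 - Re w)\<^sup>2 + (Im w)\<^sup>2 > 0" by (simp add: cmod_power2)
  have "(norm w)\<^sup>2 < 1" using assms by (simp add: power_less_one_iff)
  hence n: "(Re w)\<^sup>2 + (Im w)\<^sup>2 < 1" by (simp add: cmod_power2)
  have "Re (w / (1 - w)) = (Re w * (1 - Re w) - (Im w)\<^sup>2) / ((1 - Re w)\<^sup>2 + (Im w)\<^sup>2)"
    by (simp add: Re_divide power2_eq_square)
  moreover have "- 1 / 2 < (Re w * (1 - Re w) - (Im w)\<^sup>2) / ((1 - Re w)\<^sup>2 + (Im w)\<^sup>2)"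
    unfolding pos_less_divide_eq[OF pos] using n by (simp add: power2_eq_square algebra_simps)
  ultimately show ?thesis
    by simp
qed

text \<open>In the coordinate \<open>w = F z\<close> the shear is \<open>w \<mapsto> w + 2 Re g\<close>, whose real part has derivative
  \<open>1 + 2 Re (\<omega> / (1 - \<omega>)) > 0\<close> along horizontal lines.\<close>
lemma shear_inj_on:
  assumes parts: "horizontal_shear_parts F \<omega> h g"
    and convex: "horizontally_convex_domain (F ` \<bbbD>)"
  shows "inj_on (\<lambda>z. h z + cnj (g z)) \<bbbD>"
proof -
  have hol: "F holomorphic_on \<bbbD>" "h holomorphic_on \<bbbD>" "g holomorphic_on \<bbbD>"
    and inj: "inj_on F \<bbbD>" and \<omega>: "\<And>z. z \<in> \<bbbD> \<Longrightarrow> norm (\<omega> z) < 1"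
    and F: "\<And>z. z \<in> \<bbbD> \<Longrightarrow> h z - g z = F z"
    and g': "\<And>z. z \<in> \<bbbD> \<Longrightarrow> deriv g z = \<omega> z * deriv h z"
    using parts by (auto simp: horizontal_shear_parts_def univalent_def image_subset_iff)
  obtain k where k: "k holomorphic_on F ` \<bbbD>"
      "\<And>z. z \<in> \<bbbD> \<Longrightarrow> deriv F z * deriv k (F z) = 1" "\<And>z. z \<in> \<bbbD> \<Longrightarrow> k (F z) = z"
    using holomorphic_has_inverse[OF hol(1) _ inj] by auto
  have "open (F ` \<bbbD>)"
    using convex by (simp add: horizontally_convex_domain_def)
  \<comment> \<open>Since \<open>h = F + g\<close>, the sum of \<open>g\<close> and its conjugate is
    what is added to \<open>F\<close>: shearing moves points horizontally.\<close>
  have f: "h z + cnj (g z) = F z + 2 * of_real (Re (g z))" if "z \<in> \<bbbD>" for z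
    using F[OF that] by (simp add: complex_eq_iff algebra_simps)
  have neq: "h z1 + cnj (g z1) \<noteq> h z2 + cnj (g z2)"
    if z: "z1 \<in> \<bbbD>" "z2 \<in> \<bbbD>" and Im: "Im (F z1) = Im (F z2)" and Re: "Re (F z1) < Re (F z2)" for z1 z2
  proof -
    define y where "y = Im (F z1)"
    \<comment> \<open>The real part of the shear, read along the line of height \<open>y\<close> in
      the image of \<open>F\<close>.\<close>
    define \<phi> where "\<phi> t = t + 2 * Re (g (k (Complex t y)))" for t
    have F12: "F z1 = Complex (Re (F z1)) y" "F z2 = Complex (Re (F z2)) y"
      using Im by (simp_all add: complex_eq_iff y_def)
    have "\<phi> (Re (F z1)) < \<phi> (Re (F z2))"
    proof (rule DERIV_pos_imp_increasing[OF Re])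
      fix t assume "Re (F z1) \<le> t" "t \<le> Re (F z2)"
      hence "Complex t y \<in> F ` \<bbbD>"
        using horizontally_convex_domain_segment[OF convex] z F12 by (metis imageI)
      then obtain z where z: "z \<in> \<bbbD>" "Complex t y = F z"
        by blast
      have dF: "(F has_field_derivative deriv F z) (at z)"
        and dh: "(h has_field_derivative deriv h z) (at z)"
        and dg: "(g has_field_derivative deriv g z) (at z)"
        using hol z(1) holomorphic_derivI[OF _ open_ball] by blast+
      have dk: "(k has_field_derivative deriv k (F z)) (at (F z))"
        using k(1) \<open>open (F ` \<bbbD>)\<close> z(1) holomorphic_derivI by blast
      have "((\<lambda>z. h z - g z) has_field_derivative deriv h z - deriv g z) (at z)"
        by (intro derivative_intros dh dg)
      hence "(F has_field_derivative deriv h z - deriv g z) (at z)"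
        by (rule has_field_derivative_transform_within_open[OF _ open_ball z(1)]) (simp add: F)
      hence F': "deriv F z = (1 - \<omega> z) * deriv h z"
        using g'[OF z(1)] DERIV_imp_deriv by (force simp: algebra_simps)
      \<comment> \<open>This is \<open>g' / F'\<close>; by \<open>g' = \<omega> h'\<close> and
        \<open>F' = (1 - \<omega>) h'\<close> the factor \<open>h'\<close> drops out.\<close>
      have "deriv g z * deriv k (F z) = \<omega> z / (1 - \<omega> z)"
      proof -
        have "1 - \<omega> z \<noteq> 0"
          using \<omega>[OF z(1)] by auto
        moreover have "deriv g z * deriv k (F z) * (1 - \<omega> z) = \<omega> z * (deriv F z * deriv k (F z))"
          unfolding g'[OF z(1)] F' by (simp only: mult_ac)
        ultimately show ?thesis
          using k(2)[OF z(1)] by (simp add: eq_divide_eq)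
      qed
      moreover have "(g \<circ> k has_field_derivative deriv g z * deriv k (F z)) (at (Complex t y))"
        using DERIV_chain[of g "deriv g z" k "F z"] dg dk k(3)[OF z(1)] z by simp
      ultimately have "(g \<circ> k has_field_derivative \<omega> z / (1 - \<omega> z)) (at (Complex t y))"
        by simp
      moreover have "((\<lambda>t. Complex t y) has_vector_derivative 1) (at t)"
        unfolding Complex_eq by (auto intro!: derivative_eq_intros)
      ultimately have "((g \<circ> k) \<circ> (\<lambda>t. Complex t y) has_vector_derivative 1 * (\<omega> z / (1 - \<omega> z))) (at t)"
        by (intro field_vector_diff_chain_at)
      from bounded_linear.has_vector_derivative[OF bounded_linear_Re this]
      have "((\<lambda>t. Re (g (k (Complex t y)))) has_real_derivative Re (\<omega> z / (1 - \<omega> z))) (at t)"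
        by (simp only: o_def mult_1 has_real_derivative_iff_has_vector_derivative)
      hence "(\<phi> has_real_derivative 1 + 2 * Re (\<omega> z / (1 - \<omega> z))) (at t)"
        unfolding \<phi>_def[abs_def] by (intro DERIV_add DERIV_ident DERIV_cmult)
      moreover have "1 + 2 * Re (\<omega> z / (1 - \<omega> z)) > 0"
        using Re_divide_one_minus_gt[OF \<omega>[OF z(1)]] by linarith
      ultimately show "\<exists>d. (\<phi> has_real_derivative d) (at t) \<and> d > 0"
        by blast
    qed
    moreover have "\<phi> (Re (F z1)) = Re (h z1 + cnj (g z1))"
      unfolding \<phi>_def F12(1)[symmetric] k(3)[OF z(1)] f[OF z(1)] by simp
    moreover have "\<phi> (Re (F z2)) = Re (h z2 + cnj (g z2))"
      unfolding \<phi>_def F12(2)[symmetric] k(3)[OF z(2)] f[OF z(2)] by simp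
    ultimately show ?thesis
      by (metis less_irrefl)
  qed
  show ?thesis
  proof (rule inj_onI)
    fix z w assume z: "z \<in> \<bbbD>" and w: "w \<in> \<bbbD>" and eq: "h z + cnj (g z) = h w + cnj (g w)"
    \<comment> \<open>Equal shear values force equal heights under \<open>F\<close>, and on a single
      line strict monotonicity excludes either order.\<close>
    have "Im (F z) = Im (F w)"
      using arg_cong[OF eq, of Im] f[OF z] f[OF w] by simp
    moreover from this have "Re (F z) = Re (F w)"
      using neq[OF z w] neq[OF w z] eq by (metis linorder_less_linear)
    ultimately have "F z = F w"
      by (rule complex_eqI[rotated])
    thus "z = w"
      using inj z w by (simp add: inj_on_eq_iff)
  qed
qed

lemma shear_in_SH0:
  assumes parts: "horizontal_shear_parts F \<omega> h g"
    and convex: "horizontally_convex_domain (F ` \<bbbD>)"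
    and f: "\<And>z. z \<in> \<bbbD> \<Longrightarrow> f z = h z + cnj (g z)"
    and "deriv h 0 = 1" "\<omega> 0 = 0"
  shows "f \<in> SH0"
proof -
  have "inj_on f \<bbbD>"
    using shear_inj_on[OF parts convex] f by (simp add: inj_on_def)
  moreover have "deriv g 0 = 0"
    using parts \<open>\<omega> 0 = 0\<close> by (simp add: horizontal_shear_parts_def)
  ultimately show ?thesis
    using parts f \<open>deriv h 0 = 1\<close> unfolding SH0_def horizontal_shear_parts_def by blast
qed

section \<open>The dilatation and a criterion for shears of \<open>F_map c\<close>\<close>

lemma one_plus_mult_nonzero:
  assumes "a \<in> {-1..1::real}" "z \<in> \<bbbD>"
  shows "1 + of_real a * z \<noteq> 0"
proof -
  have "norm (of_real a * z) \<le> 1 * norm z"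
    unfolding norm_mult using assms(1) by (intro mult_right_mono) auto
  with assms(2) have "norm (of_real a * z) < 1"
    by simp
  thus ?thesis
    by (metis add_eq_0_iff norm_minus_cancel norm_one order_less_irrefl)
qed

text \<open>The Moebius factor has modulus at most 1, and exactly 1 for \<open>a = 1\<close> and
  \<open>a = -1\<close>, so strictness comes from the factor \<open>z\<close>.\<close>

lemma norm_dilat_less_1:
  assumes a: "a \<in> {-1..1}" and z: "z \<in> \<bbbD>"
  shows "norm (dilat a z) < 1"
proof -
  let ?w = "(z + of_real a) / (1 + of_real a * z)"
  have "(norm (1 + of_real a * z))\<^sup>2 - (norm (z + of_real a))\<^sup>2 = (1 - a\<^sup>2) * (1 - (norm z)\<^sup>2)"
    unfolding cmod_power2 by (simp add: power2_eq_square algebra_simps)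
  moreover have "(1 - a\<^sup>2) * (1 - (norm z)\<^sup>2) \<ge> 0"
    using a z by (intro mult_nonneg_nonneg) (auto simp: abs_square_le_1 power_le_one_iff)
  ultimately have "(norm (z + of_real a))\<^sup>2 \<le> (norm (1 + of_real a * z))\<^sup>2"
    by linarith
  hence "norm (z + of_real a) \<le> norm (1 + of_real a * z)"
    by (rule power2_le_imp_le) simp
  hence "norm ?w \<le> 1"
    by (auto simp: norm_divide divide_le_eq_1)
  hence "norm z * norm ?w \<le> norm z * 1"
    by (intro mult_left_mono) auto
  moreover have "norm (dilat a z) = norm z * norm ?w"
    by (simp add: dilat_def norm_mult norm_divide)
  moreover have "norm z < 1"
    using z by simp
  ultimately show ?thesis
    by linarith
qed

text \<open>One derivative suffices: with \<open>Q = 1 + c z + z^2\<close>, subtracting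
  \<open>F'\<close> from \<open>h' = (1 + a z) / Q^2\<close> leaves \<open>z (z + a) / Q^2\<close>,
  which is \<open>dilat a\<close> times \<open>h'\<close>. The open range and the endpoints of
  \<open>c\<close> both go through this criterion.\<close>

lemma shear_F_mapI:
  assumes c: "c \<in> {-2..2}" and a: "a \<in> {-1..1}"
    and h': "\<And>z. z \<in> \<bbbD> \<Longrightarrow>
      (h has_field_derivative (1 + of_real a * z) / (1 + of_real c * z + z\<^sup>2)\<^sup>2) (at z)"
    and "h 0 = 0" and hg: "\<And>z. z \<in> \<bbbD> \<Longrightarrow> h z - g z = F_map c z"
  shows "horizontal_shear_parts (F_map c) (dilat a) h g"
    and "(\<And>z. z \<in> \<bbbD> \<Longrightarrow> f z = h z + cnj (g z)) \<Longrightarrow> f \<in> SH0"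
proof -
  have g': "(g has_field_derivative z * (z + of_real a) / (1 + of_real c * z + z\<^sup>2)\<^sup>2) (at z)"
    if z: "z \<in> \<bbbD>" for z
  proof -
    have "((\<lambda>z. h z - F_map c z) has_field_derivative
            (1 + of_real a * z) / (1 + of_real c * z + z\<^sup>2)\<^sup>2 - (1 - z\<^sup>2) / (1 + of_real c * z + z\<^sup>2)\<^sup>2) (at z)"
      by (intro derivative_intros h' has_field_derivative_F_map c z)
    also have "(1 + of_real a * z) / (1 + of_real c * z + z\<^sup>2)\<^sup>2 - (1 - z\<^sup>2) / (1 + of_real c * z + z\<^sup>2)\<^sup>2
        = z * (z + of_real a) / (1 + of_real c * z + z\<^sup>2)\<^sup>2"
      by (simp add: diff_divide_distrib[symmetric] power2_eq_square algebra_simps)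
    finally show ?thesis
      by (rule has_field_derivative_transform_within_open[OF _ open_ball z]) (simp flip: hg)
  qed
  show parts: "horizontal_shear_parts (F_map c) (dilat a) h g"
    unfolding horizontal_shear_parts_def
  proof (intro conjI ballI)
    show "univalent (F_map c)" using c by (rule univalent_F_map)
    show F0: "F_map c 0 = 0" by (simp add: F_map_def)
    show "dilat a holomorphic_on \<bbbD>"
      unfolding dilat_def using one_plus_mult_nonzero[OF a] by (intro holomorphic_intros) auto
    show "dilat a ` \<bbbD> \<subseteq> \<bbbD>" using norm_dilat_less_1[OF a] by auto
    show "h holomorphic_on \<bbbD>" "g holomorphic_on \<bbbD>"
      unfolding holomorphic_on_open[OF open_ball] using h' g' by blast+
    show "h 0 = 0" by fact
    show "g 0 = 0" using hg[of 0] F0 \<open>h 0 = 0\<close> by simp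
    fix z assume z: "z \<in> \<bbbD>"
    show "h z - g z = F_map c z" using hg[OF z] .
    show "deriv g z = dilat a z * deriv h z"
      using DERIV_imp_deriv[OF h'[OF z]] DERIV_imp_deriv[OF g'[OF z]] one_plus_mult_nonzero[OF a z]
      by (simp add: dilat_def)
  qed
  have "deriv h 0 = 1"
    using DERIV_imp_deriv[OF h'[of 0]] by simp
  thus "f \<in> SH0" if "\<And>z. z \<in> \<bbbD> \<Longrightarrow> f z = h z + cnj (g z)"
    using shear_in_SH0[OF parts horizontally_convex_F_map_image[OF c] that] by (simp add: dilat_def)
qed

section \<open>The closed form for \<open>-2 < c < 2\<close>\<close>

lemma four_minus_square_pos:
  fixes c :: real
  assumes "c \<in> {-2<..<2}"
  shows "4 - c\<^sup>2 > 0"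
  using assms abs_square_less_1[of "c/2"] by (auto simp: power_divide)

text \<open>Both sides are half the principal logarithm of
  \<open>(1 - \<i> * z) / (1 + \<i> * z)\<close>, so no branch condition arises.\<close>

lemma artanh_eq_Arctan: "artanh (- (\<i> * z)) = - (\<i> * Arctan z)"
  by (simp add: artanh_def Arctan_def flip: mult.assoc)

lemma Arctan_minus_of_real: "Arctan (- of_real x) = - Arctan (of_real x)"
proof -
  have "complex_of_real (arctan y) = Arctan (of_real y)" for y
    by (simp add: complex_eq_iff arctan_eq_Re_Arctan)
  from this[of "- x"] this[of x] show ?thesis
    by (simp add: arctan_minus)
qed

text \<open>The negative base \<open>c - 2\<close> has principal argument \<open>pi\<close>, so its
  power \<open>3/2\<close> contributes \<open>cis (3 * pi / 2) = - \<i>\<close>; the moduli multiply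
  to \<open>(4 - c^2) powr (3/2)\<close>.\<close>

lemma \<sigma>3_mult_\<sigma>4:
  assumes "c \<in> {-2<..<2}"
  shows "\<sigma>3 c * \<sigma>4 c = - (\<i> * of_real (sqrt (4 - c\<^sup>2) ^ 3))"
proof -
  have "\<sigma>3 c = of_real ((2 - c) powr (3/2)) * exp (\<i> * pi * (3/2))"
    using assms powr_of_neg_real[of "c - 2" "3/2"] by (simp add: \<sigma>3_def)
  also have "exp (\<i> * pi * (3/2)) = cis (pi + pi / 2)"
    by (simp add: cis_conv_exp algebra_simps)
  also have "\<dots> = cis pi * cis (pi / 2)"
    by (simp only: cis_mult)
  also have "\<dots> = - \<i>"
    by simp
  finally have 3: "\<sigma>3 c = of_real ((2 - c) powr (3/2)) * - \<i>" .
  have 4: "\<sigma>4 c = of_real ((c + 2) powr (3/2))"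
    using assms powr_of_real[of "c + 2" "3/2"] by (simp add: \<sigma>4_def)
  have "(2 - c) powr (3/2) * (c + 2) powr (3/2) = (4 - c\<^sup>2) powr (3/2)"
    using assms by (subst powr_mult[symmetric]) (auto simp: power2_eq_square algebra_simps)
  also have "4 - c\<^sup>2 > 0"
    using assms(1) by (rule four_minus_square_pos)
  hence "(4 - c\<^sup>2) powr (3/2) = sqrt (4 - c\<^sup>2) ^ 3"
    by (simp add: powr_half_sqrt[symmetric] powr_powr flip: powr_realpow)
  finally have "(2 - c) powr (3/2) * (c + 2) powr (3/2) = sqrt (4 - c\<^sup>2) ^ 3" .
  hence "complex_of_real ((2 - c) powr (3/2)) * of_real ((c + 2) powr (3/2)) = of_real (sqrt (4 - c\<^sup>2) ^ 3)"
    by (metis of_real_mult)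
  thus ?thesis
    unfolding 3 4 by (metis minus_mult_commute mult.assoc mult.commute mult_minus_right)
qed

text \<open>The argument of \<open>\<sigma>2\<close> is the negative of that of
  \<open>\<sigma>1\<close> at \<open>z = 0\<close>, so the sum is a multiple of a difference of
  arctangents that vanishes there.\<close>

lemma \<sigma>1_plus_\<sigma>2:
  assumes "c \<in> {-2<..<2}"
  shows "\<sigma>1 c z + \<sigma>2 c = - \<i> * (Arctan ((of_real c + 2 * z) / of_real (sqrt (4 - c\<^sup>2)))
           - Arctan (of_real (c / sqrt (4 - c\<^sup>2))))"
proof -
  define s where "s = sqrt (4 - c\<^sup>2)"
  have "4 - c\<^sup>2 > 0"
    using assms(1) by (rule four_minus_square_pos)
  hence s: "s \<noteq> 0" "s\<^sup>2 = 4 - c\<^sup>2"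
    by (simp_all add: s_def)
  have s2: "(of_real s)\<^sup>2 = 4 - (complex_of_real c)\<^sup>2"
    using arg_cong[OF s(2), of complex_of_real] by simp
  have \<sigma>34: "\<sigma>3 c * \<sigma>4 c = - (\<i> * of_real s ^ 3)"
    using \<sigma>3_mult_\<sigma>4[OF assms] by (simp add: s_def)
  have arg1: "(of_real c ^ 2 - 4) * (of_real c + 2 * z) / (\<sigma>3 c * \<sigma>4 c) = - (\<i> * ((of_real c + 2 * z) / of_real s))"
  proof -
    have c4: "(of_real c)\<^sup>2 - 4 = - (complex_of_real s)\<^sup>2" by (simp add: s2)
    show ?thesis using s(1) unfolding c4 \<sigma>34
      by (simp add: field_simps power2_eq_square power3_eq_cube)
  qed
  have arg2: "(4 * of_real c - of_real c ^ 3) / (\<sigma>3 c * \<sigma>4 c) = - (\<i> * - of_real (c / s))"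
  proof -
    have c4: "4 * of_real c - of_real c ^ 3 = of_real c * (complex_of_real s)\<^sup>2"
      unfolding s2 by (simp add: power2_eq_square power3_eq_cube algebra_simps)
    show ?thesis using s(1) unfolding c4 \<sigma>34
      by (simp add: field_simps power2_eq_square power3_eq_cube)
  qed
  show ?thesis
    unfolding \<sigma>1_def \<sigma>2_def arg1 arg2 artanh_eq_Arctan Arctan_minus_of_real
    by (simp add: s_def algebra_simps)
qed

text \<open>The quadratic factor cancels against \<open>q_fun\<close>, so the arctangents enter
  \<open>h_fun\<close> and \<open>g_fun\<close> with constant coefficients.\<close>

lemma K_poly_eq:
  "K_poly c a z = (4 - of_real c ^ 2) * (4 - 2 * of_real a * of_real c) * (1 + of_real c * z + z\<^sup>2)"
  by (simp add: K_poly_def Let_def power2_eq_square power3_eq_cube power4_eq_xxxx algebra_simps)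

text \<open>The transcendental terms of \<open>p_fun\<close> and \<open>r_fun\<close> coincide and
  cancel.\<close>

lemma h_fun_minus_g_fun:
  assumes "c \<in> {-2<..<2}"
  shows "h_fun c a z - g_fun c a z = F_map c z"
proof -
  have "4 - c\<^sup>2 > 0"
    using assms(1) by (rule four_minus_square_pos)
  hence "\<sigma>3 c * \<sigma>4 c \<noteq> 0"
    unfolding \<sigma>3_mult_\<sigma>4[OF assms] by simp
  moreover have "complex_of_real (4 - c\<^sup>2) \<noteq> 0"
    using \<open>4 - c\<^sup>2 > 0\<close> unfolding of_real_eq_0_iff by simp
  hence "(of_real c)\<^sup>2 - 4 \<noteq> (0::complex)"
    by simp
  moreover have pr: "p_fun c a z - r_fun c a z = - (((of_real c)\<^sup>2 - 4) * (\<sigma>3 c * \<sigma>4 c)) * z"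
    by (simp add: p_fun_def r_fun_def Let_def algebra_simps)
  moreover have "h_fun c a z - g_fun c a z = - ((p_fun c a z - r_fun c a z) / q_fun c z)"
    by (simp add: h_fun_def g_fun_def diff_divide_distrib)
  ultimately show ?thesis
    by (simp add: pr F_map_def q_fun_def Let_def mult.assoc)
qed

text \<open>The imaginary factors cancel between numerator and denominator. This is the form that is
  differentiated.\<close>

lemma h_fun_eq:
  assumes "c \<in> {-2<..<2}" and Q: "1 + of_real c * z + z\<^sup>2 \<noteq> 0"
  defines "s \<equiv> complex_of_real (sqrt (4 - c\<^sup>2))"
  shows "h_fun c a z = (4 - 2 * of_real a * of_real c) / s ^ 3 *
            (Arctan ((of_real c + 2 * z) / s) - Arctan (of_real c / s))
          + (2 * z + 2 * of_real a * z^2 - of_real c * z^2 - of_real c^2 * z + of_real a * of_real c * z)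
            / (s\<^sup>2 * (1 + of_real c * z + z\<^sup>2))"
proof -
  have "4 - c\<^sup>2 > 0"
    using assms(1) by (rule four_minus_square_pos)
  hence s: "s \<noteq> 0" by (simp add: s_def)
  have s2: "s\<^sup>2 = 4 - (complex_of_real c)\<^sup>2"
    using \<open>4 - c\<^sup>2 > 0\<close> by (simp add: s_def flip: of_real_power)
  define B where "B = Arctan ((of_real c + 2 * z) / s) - Arctan (of_real c / s)"
  define N where "N = 2 * z + 2 * of_real a * z^2 - of_real c * z^2 - of_real c^2 * z + of_real a * of_real c * z"
  define m where "m = (4 - 2 * of_real a * complex_of_real c)"
  define Q where "Q = 1 + of_real c * z + z\<^sup>2"
  have p: "p_fun c a z = - \<i> * B * (s\<^sup>2 * m * Q) - \<i> * s ^ 3 * N"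
    unfolding p_fun_def Let_def \<sigma>1_plus_\<sigma>2[OF assms(1)] \<sigma>3_mult_\<sigma>4[OF assms(1)] K_poly_eq s2 B_def N_def m_def Q_def
    by (simp add: s_def)
  have q: "q_fun c z = \<i> * s ^ 5 * Q"
  proof -
    have "q_fun c z = - (s\<^sup>2) * (- (\<i> * s ^ 3)) * Q"
      unfolding q_fun_def Let_def s2 Q_def using \<sigma>3_mult_\<sigma>4[OF assms(1)]
      by (simp add: s_def mult.assoc)
    also have "\<dots> = \<i> * s ^ 5 * Q" by (simp add: power_def)
    finally show ?thesis .
  qed
  have "Q \<noteq> 0" using Q by (simp add: Q_def)
  hence "h_fun c a z = m / s ^ 3 * B + N / (s\<^sup>2 * Q)"
    unfolding h_fun_def p q using s by (simp add: divide_simps) (simp add: algebra_simps power_def)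
  thus ?thesis by (simp add: B_def N_def m_def Q_def)
qed

lemma has_field_derivative_h_fun:
  assumes c: "c \<in> {-2<..<2}" and z: "z \<in> \<bbbD>"
  shows "(h_fun c a has_field_derivative (1 + of_real a * z) / (1 + of_real c * z + z\<^sup>2)\<^sup>2) (at z)"
proof -
  define s where "s = sqrt (4 - c\<^sup>2)"
  define S where "S = complex_of_real s"
  define C where "C = complex_of_real c"
  define A where "A = complex_of_real a"
  define Q where "Q = (\<lambda>z. 1 + C * z + z\<^sup>2)"
  define N where "N = (\<lambda>z. 2 * z + 2 * A * z^2 - C * z^2 - C^2 * z + A * C * z)"
  define N' where "N' = 2 + 4 * A * z - 2 * C * z - C^2 + A * C"
  have Q: "Q z \<noteq> 0" if "z \<in> \<bbbD>" for z
    using F_map_denominator_nonzero[of c z] c that by (simp add: Q_def C_def)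
  have "4 - c\<^sup>2 > 0"
    using c by (rule four_minus_square_pos)
  hence s: "s > 0" "s\<^sup>2 = 4 - c\<^sup>2"
    by (simp_all add: s_def)
  have S: "S \<noteq> 0" "S\<^sup>2 = 4 - C\<^sup>2"
    using s(1) arg_cong[OF s(2), of complex_of_real] by (simp_all add: S_def C_def)
  define w where "w = (C + 2 * z) / S"
  \<comment> \<open>The cuts of \<open>Arctan\<close> run along the imaginary axis outwards from
    \<open>\<i>\<close> and \<open>- \<i>\<close>. \<open>w\<close> is imaginary only for
    \<open>Re z = - c / 2\<close>, and there \<open>norm z < 1\<close> bounds
    \<open>\<bar>2 * Im z\<bar>\<close> by \<open>s\<close>.\<close>
  have w_strip: "\<bar>Im w\<bar> < 1" if "Re w = 0"
  proof -
    have Re: "Re z = - c / 2"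
      using that s(1) by (simp add: w_def C_def S_def)
    have "(norm z)\<^sup>2 < 1"
      using z by (simp add: power_less_one_iff)
    hence "(2 * Im z)\<^sup>2 < s\<^sup>2"
      by (simp add: s(2) cmod_power2 Re power_divide)
    hence "\<bar>2 * Im z\<bar> < s"
      using s(1) by (intro power2_less_imp_less[of "\<bar>2 * Im z\<bar>" s]) simp_all
    thus ?thesis
      using s(1) by (simp add: w_def C_def S_def)
  qed
  \<comment> \<open>Completing the square in \<open>Q\<close> makes the derivative of the arctangent
    a constant multiple of \<open>1 / Q\<close>.\<close>
  have "1 + w\<^sup>2 = 4 * Q z / S\<^sup>2"
  proof -
    have "(1 + w\<^sup>2) * S\<^sup>2 = S\<^sup>2 + (C + 2 * z)\<^sup>2"
      using S(1) by (simp add: w_def power_divide distrib_right)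
    also have "\<dots> = 4 * Q z"
      unfolding S(2) by (simp add: Q_def power2_eq_square algebra_simps)
    finally show ?thesis
      using S(1) by (simp add: eq_divide_eq)
  qed
  hence "inverse (1 + w\<^sup>2) * (2 / S) = S / (2 * Q z)"
    using S(1) Q[OF z] by (simp add: power2_eq_square)
  moreover have "((\<lambda>z. (C + 2 * z) / S) has_field_derivative 2 / S) (at z)"
    by (auto intro!: derivative_eq_intros simp: S(1))
  hence "((\<lambda>z. Arctan ((C + 2 * z) / S)) has_field_derivative inverse (1 + w\<^sup>2) * (2 / S)) (at z)"
    using has_field_derivative_Arctan[of w] w_strip unfolding w_def by (intro DERIV_chain2) auto
  ultimately have "((\<lambda>z. Arctan ((C + 2 * z) / S) - Arctan (C / S)) has_field_derivative S / (2 * Q z) - 0) (at z)"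
    by (intro DERIV_diff) auto
  hence "((\<lambda>z. (4 - 2 * A * C) / S ^ 3 * (Arctan ((C + 2 * z) / S) - Arctan (C / S)))
           has_field_derivative (4 - 2 * A * C) / S ^ 3 * (S / (2 * Q z) - 0)) (at z)"
    by (rule DERIV_cmult)
  moreover have "(N has_field_derivative N') (at z)"
    unfolding N_def N'_def by (auto intro!: derivative_eq_intros)
  hence "((\<lambda>z. N z / (S\<^sup>2 * Q z)) has_field_derivative
           (N' * (S\<^sup>2 * Q z) - N z * (S\<^sup>2 * (C + 2 * z))) / ((S\<^sup>2 * Q z) * (S\<^sup>2 * Q z))) (at z)"
    using S(1) Q[OF z]
    by (intro DERIV_divide DERIV_cmult) (auto simp: Q_def intro!: derivative_eq_intros)
  ultimately have "((\<lambda>z. (4 - 2 * A * C) / S ^ 3 * (Arctan ((C + 2 * z) / S) - Arctan (C / S)) + N z / (S\<^sup>2 * Q z))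
      has_field_derivative (4 - 2 * A * C) / S ^ 3 * (S / (2 * Q z) - 0)
        + (N' * (S\<^sup>2 * Q z) - N z * (S\<^sup>2 * (C + 2 * z))) / ((S\<^sup>2 * Q z) * (S\<^sup>2 * Q z))) (at z)"
    by (rule DERIV_add)
  also have "(4 - 2 * A * C) / S ^ 3 * (S / (2 * Q z) - 0)
        + (N' * (S\<^sup>2 * Q z) - N z * (S\<^sup>2 * (C + 2 * z))) / ((S\<^sup>2 * Q z) * (S\<^sup>2 * Q z))
      = (1 + A * z) / (Q z)\<^sup>2"
  proof -
    have 1: "(4 - 2 * A * C) / S ^ 3 * (S / (2 * Q z) - 0) = (2 - A * C) * Q z / (S\<^sup>2 * (Q z)\<^sup>2)"
      using S(1) Q[OF z] by (simp add: divide_simps power2_eq_square power3_eq_cube)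
    have 2: "(N' * (S\<^sup>2 * Q z) - N z * (S\<^sup>2 * (C + 2 * z))) / ((S\<^sup>2 * Q z) * (S\<^sup>2 * Q z))
        = (N' * Q z - N z * (C + 2 * z)) / (S\<^sup>2 * (Q z)\<^sup>2)"
    proof -
      have num: "N' * (S\<^sup>2 * Q z) - N z * (S\<^sup>2 * (C + 2 * z)) = S\<^sup>2 * (N' * Q z - N z * (C + 2 * z))"
        by (simp add: algebra_simps)
      have den: "(S\<^sup>2 * Q z) * (S\<^sup>2 * Q z) = S\<^sup>2 * (S\<^sup>2 * (Q z)\<^sup>2)"
        by (simp add: power2_eq_square)
      show ?thesis
        unfolding num den using S(1) by (subst mult_divide_mult_cancel_left) auto
    qed
    \<comment> \<open>Over the common denominator \<open>S^2 * Q^2\<close> all terms of degree above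
      one cancel, and \<open>S^2\<close> factors out of the rest.\<close>
    have "(2 - A * C) * Q z + (N' * Q z - N z * (C + 2 * z)) = S\<^sup>2 * (1 + A * z)"
      unfolding S(2) N_def N'_def Q_def by (simp add: power2_eq_square algebra_simps)
    thus ?thesis
      unfolding 1 2 add_divide_distrib[symmetric] using S(1) by simp
  qed
  finally have "((\<lambda>z. (4 - 2 * A * C) / S ^ 3 * (Arctan ((C + 2 * z) / S) - Arctan (C / S)) + N z / (S\<^sup>2 * Q z))
      has_field_derivative (1 + A * z) / (Q z)\<^sup>2) (at z)" .
  hence "(h_fun c a has_field_derivative (1 + A * z) / (Q z)\<^sup>2) (at z)"
  proof (rule has_field_derivative_transform_within_open[OF _ open_ball z])
    fix u assume "u \<in> \<bbbD>"
    from h_fun_eq[OF c Q[OF this, unfolded Q_def C_def]]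
    show "(4 - 2 * A * C) / S ^ 3 * (Arctan ((C + 2 * u) / S) - Arctan (C / S)) + N u / (S\<^sup>2 * Q u) = h_fun c a u"
      by (simp add: A_def C_def N_def Q_def S_def s_def)
  qed
  thus ?thesis
    by (simp add: A_def C_def Q_def)
qed

section \<open>The boundary cases \<open>c = -2\<close> and \<open>c = 2\<close>\<close>

text \<open>Both boundary cases at once: \<open>e = 1\<close> is \<open>c = -2\<close> and \<open>e = -1\<close> is \<open>c = 2\<close>; the fraction
  with the denominator \<open>(z - e)\<^sup>3\<close> is \<open>h + g\<close>.\<close>
lemma shear_F_map_boundary:
  fixes e :: real
  assumes e: "e = 1 \<or> e = -1" and a: "a \<in> {-1..1}"
    and f: "\<And>z. z \<in> \<bbbD> \<Longrightarrow> f z = Complex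
      (Re (of_real a / 3 - (z\<^sup>2 + (of_real a - of_real e) * z - of_real (e * a) / 3 + 2/3) / (z - of_real e) ^ 3
           - of_real (2 * e / 3)))
      (Im (F_map (- 2 * e) z))"
  shows "horizontal_shear (F_map (- 2 * e)) (dilat a) f" and "f \<in> SH0"
proof -
  define E where "E = complex_of_real e"
  define A where "A = complex_of_real a"
  define H where "H = (\<lambda>z. A / 3 - (z\<^sup>2 + (A - E) * z - E * A / 3 + 2/3) / (z - E) ^ 3 - 2 * E / 3)"
  \<comment> \<open>\<open>H\<close> plays the role of \<open>h + g\<close> and
    \<open>F_map (- 2 * e)\<close> that of \<open>h - g\<close>; the constants in \<open>H\<close>
    make it vanish at 0.\<close>
  define h where "h = (\<lambda>z. 1 / 2 * (H z + F_map (- 2 * e) z))"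
  define g where "g = (\<lambda>z. 1 / 2 * (H z - F_map (- 2 * e) z))"
  have c: "- 2 * e \<in> {-2..2}" using e by auto
  have EE: "E * E = 1" "E ^ 3 = E" using e by (auto simp: E_def)
  have Q: "1 + of_real (- 2 * e) * z + z\<^sup>2 = (z - E)\<^sup>2" for z
    using EE by (simp add: E_def power2_eq_square algebra_simps)
  have h': "(h has_field_derivative (1 + of_real a * z) / (1 + of_real (- 2 * e) * z + z\<^sup>2)\<^sup>2) (at z)"
    if z: "z \<in> \<bbbD>" for z
  proof -
    have nz: "z - E \<noteq> 0" using z e by (auto simp: E_def)
    have "(H has_field_derivative - (((2 * z + (A - E)) * (z - E) ^ 3
        - (z\<^sup>2 + (A - E) * z - E * A / 3 + 2/3) * (3 * (z - E)\<^sup>2)) / ((z - E) ^ 3 * (z - E) ^ 3))) (at z)"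
      unfolding H_def using nz by (auto intro!: derivative_eq_intros)
    also have "- (((2 * z + (A - E)) * (z - E) ^ 3
        - (z\<^sup>2 + (A - E) * z - E * A / 3 + 2/3) * (3 * (z - E)\<^sup>2)) / ((z - E) ^ 3 * (z - E) ^ 3))
      = (1 + 2 * A * z + z\<^sup>2) / ((z - E)\<^sup>2)\<^sup>2"
    proof -
      \<comment> \<open>Once \<open>(z - E)^2\<close> is cancelled, what remains is the numerator of
        \<open>h' + g'\<close>, namely \<open>(1 + A z) + z (z + A)\<close>.\<close>
      have "- ((2 * z + (A - E)) * (z - E) - 3 * (z\<^sup>2 + (A - E) * z - E * A / 3 + 2/3)) = 1 + 2 * A * z + z\<^sup>2"
        using EE by (simp add: power2_eq_square algebra_simps)
      moreover have "- ((2 * z + (A - E)) * (z - E) ^ 3 - (z\<^sup>2 + (A - E) * z - E * A / 3 + 2/3) * (3 * (z - E)\<^sup>2))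
        = - ((2 * z + (A - E)) * (z - E) - 3 * (z\<^sup>2 + (A - E) * z - E * A / 3 + 2/3)) * (z - E)\<^sup>2"
        by (simp add: power_def algebra_simps)
      moreover have "(z - E) ^ 3 * (z - E) ^ 3 = ((z - E)\<^sup>2)\<^sup>2 * (z - E)\<^sup>2"
        by (simp flip: power_mult power_add)
      ultimately show ?thesis
        using nz by (metis (no_types, lifting) minus_divide_left mult_divide_mult_cancel_right power_not_zero)
    qed
    finally have "(h has_field_derivative
        1 / 2 * ((1 + 2 * A * z + z\<^sup>2) / ((z - E)\<^sup>2)\<^sup>2 + (1 - z\<^sup>2) / ((z - E)\<^sup>2)\<^sup>2)) (at z)"
      unfolding h_def Q[symmetric] by (intro DERIV_cmult DERIV_add has_field_derivative_F_map c z)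
    also have "1 / 2 * ((1 + 2 * A * z + z\<^sup>2) / ((z - E)\<^sup>2)\<^sup>2 + (1 - z\<^sup>2) / ((z - E)\<^sup>2)\<^sup>2)
        = (1 + A * z) / ((z - E)\<^sup>2)\<^sup>2"
    proof -
      have "(1 + 2 * A * z + z\<^sup>2) + (1 - z\<^sup>2) = 2 * (1 + A * z)"
        by simp
      moreover have "1 / 2 * (2 * x / y) = x / y" for x y :: complex
        by simp
      ultimately show ?thesis
        unfolding add_divide_distrib[symmetric] by (simp only:)
    qed
    finally show ?thesis
      by (simp only: Q A_def)
  qed
  have "h 0 = 0"
    using e by (auto simp: h_def H_def F_map_def E_def)
  have hg: "h z - g z = F_map (- 2 * e) z" for z
    by (simp add: h_def g_def algebra_simps)
  have H: "H z = h z + g z" for z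
    by (simp add: h_def g_def algebra_simps)
  have "Complex (Re (H z)) (Im (F_map (- 2 * e) z)) = h z + cnj (g z)" for z
    unfolding H[of z] hg[of z, symmetric] by (simp add: complex_eq_iff)
  hence f_eq: "f z = h z + cnj (g z)" if "z \<in> \<bbbD>" for z
    using f[OF that] by (simp add: H_def A_def E_def)
  show "horizontal_shear (F_map (- 2 * e)) (dilat a) f"
    unfolding horizontal_shear_def using shear_F_mapI(1)[OF c a h' \<open>h 0 = 0\<close> hg] f_eq by blast
  show "f \<in> SH0"
    by (rule shear_F_mapI(2)[OF c a h' \<open>h 0 = 0\<close> hg f_eq])
qed

text \<open>The squared Cayley transform minus 1 is four times the Koebe function
  \<open>F_map (-2)\<close>, whence the factor \<open>1/4\<close>. The unevaluated literals match
  the boundary lemma at \<open>e = 1\<close>.\<close>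

lemma f_minus2_eq_shear:
  assumes "z \<in> \<bbbD>"
  shows "f_minus2 a z = Complex
      (Re (of_real a / 3 - (z\<^sup>2 + (of_real a - of_real 1) * z - of_real (1 * a) / 3 + 2/3) / (z - of_real 1) ^ 3
           - of_real (2 * 1 / 3)))
      (Im (F_map (- 2 * 1) z))"
proof -
  have "1 - z \<noteq> 0" using assms by auto
  hence "((1 + z) / (1 - z))\<^sup>2 - 1 = ((1 + z)\<^sup>2 - (1 - z)\<^sup>2) / (1 - z)\<^sup>2"
    by (subst power_divide, subst diff_divide_distrib) simp
  also have "(1 + z)\<^sup>2 - (1 - z)\<^sup>2 = of_real 4 * z"
    by (simp add: power2_eq_square algebra_simps)
  also have "(1 - z)\<^sup>2 = 1 + of_real (- 2 * 1) * z + z\<^sup>2"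
    by (simp add: power2_eq_square algebra_simps)
  also have "of_real 4 * z / (1 + of_real (- 2 * 1) * z + z\<^sup>2) = of_real 4 * F_map (- 2 * 1) z"
    by (simp add: F_map_def)
  finally have "Im (((1 + z) / (1 - z))\<^sup>2 - 1) = 4 * Im (F_map (- 2 * 1) z)"
    by (simp only: times_complex.sel Re_complex_of_real Im_complex_of_real)
  thus ?thesis
    by (simp add: f_minus2_def Let_def complex_eq_iff)
qed

lemma f_plus2_eq_shear:
  "f_plus2 a z = Complex
      (Re (of_real a / 3 - (z\<^sup>2 + (of_real a - of_real (-1)) * z - of_real ((-1) * a) / 3 + 2/3) / (z - of_real (-1)) ^ 3
           - of_real (2 * (-1) / 3)))
      (Im (F_map (- 2 * (-1)) z))"
proof -
  have square: "(1 + z)\<^sup>2 = 1 + 2 * z + z\<^sup>2"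
    by (simp add: power2_eq_square algebra_simps)
  show ?thesis
    unfolding f_plus2_def F_map_def Let_def square by (simp add: complex_eq_iff)
qed

section \<open>Images of the disk as slit domains\<close>

text \<open>\<open>h + g\<close> becomes an odd cubic in \<open>\<zeta>\<close> plus a constant, its
  value at \<open>\<zeta> = 0\<close>, that is \<open>z = -1\<close>; for \<open>a > -1\<close> this
  is the tip of the slit.\<close>

lemma f_minus2_cayley:
  assumes "z \<noteq> 1"
  defines "\<zeta> \<equiv> (1 + z) / (1 - z)"
  shows "f_minus2 a z = Complex (- (2 - a) / 6 + Re (of_real ((1 + a) / 12) * \<zeta> ^ 3 + of_real ((1 - a) / 4) * \<zeta>))
                                (Im (\<zeta>\<^sup>2) / 4)"
proof -
  have nz: "z - 1 \<noteq> 0" using assms by simp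
  have \<zeta>: "\<zeta> = - (1 + z) / (z - 1)"
    unfolding \<zeta>_def by (metis minus_diff_eq minus_divide_divide minus_minus)
  have "of_real a / 3 - (z\<^sup>2 + (of_real a - 1) * z - of_real a / 3 + 2/3) / (z - 1)^3 - 2/3
       = of_real (- (2 - a) / 6) + (of_real ((1 + a) / 12) * \<zeta> ^ 3 + of_real ((1 - a) / 4) * \<zeta>)"
    unfolding \<zeta> using nz by (simp add: divide_simps) (simp add: algebra_simps power2_eq_square power3_eq_cube)
  from arg_cong[OF this, of Re] show ?thesis
    by (simp add: f_minus2_def Let_def complex_eq_iff flip: \<zeta>_def)
qed

lemma Re_cayley_pos_iff:
  assumes "z \<noteq> 1"
  shows "Re ((1 + z) / (1 - z)) > 0 \<longleftrightarrow> norm z < 1"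
proof -
  have "0 < (cmod (1 - z))\<^sup>2" using assms by simp
  hence pos: "(1 - Re z)\<^sup>2 + (Im z)\<^sup>2 > 0" by (simp add: cmod_power2)
  have "Re ((1 + z) / (1 - z)) = (1 - (norm z)\<^sup>2) / ((1 - Re z)\<^sup>2 + (Im z)\<^sup>2)"
    by (simp add: Re_divide cmod_power2) (simp add: power2_eq_square algebra_simps)
  thus ?thesis
    using pos by (simp add: zero_less_divide_iff power_less_one_iff)
qed

lemma f_minus2_image:
  assumes a: "a \<in> {-1<..1}"
  shows "f_minus2 a ` \<bbbD> = left_slit_domain (- (2 - a) / 6)"
proof (intro equalityI subsetI)
  define t where "t = - (2 - a) / 6"
  {
    fix w assume "w \<in> f_minus2 a ` \<bbbD>"
    then obtain z where z: "z \<in> \<bbbD>" "w = f_minus2 a z" by blast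
    have "z \<noteq> 1" using z by auto
    define \<zeta> where "\<zeta> = (1 + z) / (1 - z)"
    have pos: "Re \<zeta> > 0"
      unfolding \<zeta>_def using z Re_cayley_pos_iff[OF \<open>z \<noteq> 1\<close>] by simp
    have w: "w = Complex (t + Re (of_real ((1 + a) / 12) * \<zeta> ^ 3 + of_real ((1 - a) / 4) * \<zeta>)) (Im (\<zeta>\<^sup>2) / 4)"
      using f_minus2_cayley[OF \<open>z \<noteq> 1\<close>] z by (simp add: \<zeta>_def t_def)
    \<comment> \<open>In the right half-plane a real \<open>\<zeta>^2\<close> forces
      \<open>\<zeta>\<close> to be real, and the odd cubic is positive on the positive axis.\<close>
    have "Re w > t" if "Im w = 0"
    proof -
      have "Im \<zeta> = 0"
        using that pos by (simp add: w power2_eq_square)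
      then obtain x where x: "\<zeta> = of_real x"
        by (metis complex_is_Real_iff of_real_Re)
      have "(1 + a) / 12 * x ^ 3 + (1 - a) / 4 * x > 0"
        using a pos x by (intro add_pos_nonneg mult_pos_pos mult_nonneg_nonneg) auto
      thus ?thesis
        by (simp add: w x flip: of_real_power)
    qed
    thus "w \<in> left_slit_domain (- (2 - a) / 6)"
      by (auto simp: left_slit_domain_def t_def)
  }
  {
    fix w assume w: "w \<in> left_slit_domain (- (2 - a) / 6)"
    define u v where "u = Re w" and "v = Im w"
    have uv: "v \<noteq> 0 \<or> u > t"
    proof (rule ccontr)
      assume "\<not> ?thesis"
      hence "w = of_real u" "u \<le> t"
        by (auto simp: complex_eq_iff u_def v_def)
      thus False using w by (auto simp: left_slit_domain_def t_def)
    qed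
    \<comment> \<open>The coefficient of \<open>\<zeta>^3\<close>. As it is positive, the real part
      at height \<open>v \<noteq> 0\<close> tends to minus infinity when \<open>x\<close> tends to
      0; at \<open>a = -1\<close> it would vanish and the image would be a half-plane.\<close>
    define k where "k = (1 + a) / 12"
    have k: "k > 0" using a by (simp add: k_def)
    \<comment> \<open>The equation for the real part at \<open>\<zeta> = x + i y\<close> with
      \<open>y = 2 * v / x\<close>, using \<open>Re (\<zeta>^3) = x^3 - 3 x y^2\<close>.\<close>
    obtain x where x: "x > 0" "t + k * (x ^ 3 - 12 * v\<^sup>2 / x) + (1 - a) / 4 * x = u"
    proof (cases "v = 0")
      case True
      define \<psi> where "\<psi> x = t - u + k * x ^ 3 + (1 - a) / 4 * x" for x
      have "filterlim \<psi> at_top at_top"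
        unfolding \<psi>_def using k by real_asymp
      hence "eventually (\<lambda>x. \<psi> x > 0) at_top"
        by (simp add: filterlim_at_top_dense)
      hence "eventually (\<lambda>x. \<psi> x > 0 \<and> x > 0) at_top"
        using eventually_gt_at_top by (rule eventually_conj)
      then obtain X where X: "\<psi> X > 0" "X > 0"
        unfolding eventually_at_top_linorder by blast
      \<comment> \<open>Here the tip enters: the value is \<open>t - u\<close>.\<close>
      have "\<psi> 0 < 0" using True uv by (simp add: \<psi>_def)
      have "\<exists>x\<ge>0. x \<le> X \<and> \<psi> x = 0"
        using X \<open>\<psi> 0 < 0\<close> by (intro IVT') (auto simp: \<psi>_def intro!: continuous_intros)
      then obtain x where "x \<ge> 0" "\<psi> x = 0" by blast
      moreover have "x \<noteq> 0" using \<open>\<psi> 0 < 0\<close> \<open>\<psi> x = 0\<close> by auto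
      ultimately show ?thesis using True by (intro that[of x]) (auto simp: \<psi>_def)
    next
      case False
      \<comment> \<open>Multiplication by \<open>x\<close> removes the pole at 0, so the
        intermediate value theorem applies from 0 on, where the value is
        \<open>- 12 * k * v^2\<close>.\<close>
      define \<psi> where "\<psi> x = k * (x ^ 4 - 12 * v\<^sup>2) + (1 - a) / 4 * x\<^sup>2 + (t - u) * x" for x
      have "filterlim \<psi> at_top at_top"
        unfolding \<psi>_def using k by real_asymp
      hence "eventually (\<lambda>x. \<psi> x > 0) at_top"
        by (simp add: filterlim_at_top_dense)
      hence "eventually (\<lambda>x. \<psi> x > 0 \<and> x > 0) at_top"
        using eventually_gt_at_top by (rule eventually_conj)
      then obtain X where X: "\<psi> X > 0" "X > 0"
        unfolding eventually_at_top_linorder by blast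
      have "\<psi> 0 < 0" using False k by (simp add: \<psi>_def)
      have "\<exists>x\<ge>0. x \<le> X \<and> \<psi> x = 0"
        using X \<open>\<psi> 0 < 0\<close> by (intro IVT') (auto simp: \<psi>_def intro!: continuous_intros)
      then obtain x where "x \<ge> 0" "\<psi> x = 0" by blast
      moreover have "x \<noteq> 0" using \<open>\<psi> 0 < 0\<close> \<open>\<psi> x = 0\<close> by auto
      moreover from this have "\<psi> x = x * (t + k * (x ^ 3 - 12 * v\<^sup>2 / x) + (1 - a) / 4 * x - u)"
        by (simp add: \<psi>_def field_simps power2_eq_square power3_eq_cube power4_eq_xxxx)
      ultimately show ?thesis by (intro that[of x]) auto
    qed
    define \<zeta> where "\<zeta> = Complex x (2 * v / x)"
    define z where "z = (\<zeta> - 1) / (\<zeta> + 1)"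
    have "\<zeta> + 1 \<noteq> 0" using x(1) by (simp add: complex_eq_iff \<zeta>_def)
    hence z1: "1 - z = 2 / (\<zeta> + 1)" "1 + z = 2 * \<zeta> / (\<zeta> + 1)"
      by (simp_all add: z_def field_simps)
    have "z \<noteq> 1" using z1(1) \<open>\<zeta> + 1 \<noteq> 0\<close> by auto
    have \<zeta>: "(1 + z) / (1 - z) = \<zeta>"
      unfolding z1 using \<open>\<zeta> + 1 \<noteq> 0\<close> by simp
    have "norm z < 1"
      using Re_cayley_pos_iff[OF \<open>z \<noteq> 1\<close>] x(1) by (simp add: \<zeta>) (simp add: \<zeta>_def)
    moreover have "f_minus2 a z = w"
    proof -
      have "Re (\<zeta> ^ 3) = x ^ 3 - 12 * v\<^sup>2 / x"
        using x(1) by (simp add: \<zeta>_def power3_eq_cube power2_eq_square field_simps)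
      moreover have "Im (\<zeta>\<^sup>2) = 4 * v"
        using x(1) by (simp add: \<zeta>_def power2_eq_square)
      moreover have "Re \<zeta> = x" by (simp add: \<zeta>_def)
      moreover have "Re (of_real r * y) = r * Re y" for r y by simp
      ultimately show ?thesis
        unfolding f_minus2_cayley[OF \<open>z \<noteq> 1\<close>] \<zeta> using x(2)
        by (simp only: plus_complex.simps) (simp add: complex_eq_iff k_def t_def u_def v_def)
    qed
    ultimately show "w \<in> f_minus2 a ` \<bbbD>" by auto
  }
qed

text \<open>Reflecting \<open>z\<close> exchanges the poles at -1 and 1, and with them the
  parameters \<open>c = 2\<close>, \<open>a\<close> and \<open>c = -2\<close>,
  \<open>- a\<close>.\<close>

lemma f_plus2_eq_f_minus2: "f_plus2 a z = - f_minus2 (- a) (- z)"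
\<comment> \<open>At the pole the quotients with vanishing denominator are 0 on both sides, and the
  identity persists.\<close>
proof (cases "z = - 1")
  case True
  show ?thesis unfolding True by (simp add: f_plus2_def f_minus2_def Let_def)
next
  case False
  hence nz: "1 + z \<noteq> 0" by (simp add: add_eq_0_iff)
  have cube: "(- z - 1)^3 = - ((z + 1)^3)" by (simp add: power3_eq_cube algebra_simps)
  have "((1 - z) / (1 + z))\<^sup>2 - 1 = ((1 - z)\<^sup>2 - (1 + z)\<^sup>2) / (1 + z)\<^sup>2"
    using nz by (subst power_divide, subst diff_divide_distrib) simp
  also have "(1 - z)\<^sup>2 - (1 + z)\<^sup>2 = of_real (- 4) * z"
    by (simp add: power2_eq_square algebra_simps)
  also have "\<dots> / (1 + z)\<^sup>2 = of_real (- 4) * (z / (1 + z)\<^sup>2)"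
    by simp
  finally have Im: "Im (((1 - z) / (1 + z))\<^sup>2 - 1) = - 4 * Im (z / (1 + z)\<^sup>2)"
    by (simp only: times_complex.sel Re_complex_of_real Im_complex_of_real)
  show ?thesis
    using Im by (simp add: f_plus2_def f_minus2_def Let_def complex_eq_iff cube algebra_simps)
qed

text \<open>Reflection through 0 turns the left slit with tip \<open>- (2 + a) / 6\<close> into this
  right slit, and \<open>a < 1\<close> becomes \<open>- a > -1\<close>.\<close>

lemma f_plus2_image:
  assumes a: "a \<in> {-1..<1}"
  shows "f_plus2 a ` \<bbbD> = right_slit_domain ((a + 2) / 6)"
proof -
  have "uminus ` \<bbbD> = \<bbbD>"
    by (force intro: rev_image_eqI[of "- _"])
  hence "f_plus2 a ` \<bbbD> = uminus ` f_minus2 (- a) ` \<bbbD>"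
    unfolding f_plus2_eq_f_minus2 image_image by (metis image_image)
  also have "\<dots> = uminus ` left_slit_domain (- (2 - - a) / 6)"
    using a by (subst f_minus2_image) auto
  also have "\<dots> = right_slit_domain ((a + 2) / 6)"
  proof -
    have "w \<in> complex_of_real ` S \<longleftrightarrow> Im w = 0 \<and> Re w \<in> S" for w S
      by (auto simp: complex_eq_iff intro!: image_eqI[of _ _ "Re w"])
    hence "- w \<in> left_slit_domain (- (2 - - a) / 6) \<longleftrightarrow> w \<in> right_slit_domain ((a + 2) / 6)" for w
      by (auto simp: left_slit_domain_def right_slit_domain_def)
    thus ?thesis by (force intro: rev_image_eqI[of "- _"])
  qed
  finally show ?thesis .
qed

theorem theorem4:
  shows
    "(\<forall>c\<in>{-2..2}. univalent (F_map c) \<and> horizontally_convex_domain (F_map c ` \<bbbD>)) \<and>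
     (\<forall>c\<in>{-2<..<2}. \<forall>a\<in>{-1..1}.
        horizontal_shear_parts (F_map c) (dilat a) (h_fun c a) (g_fun c a) \<and>
        f_fun c a \<in> SH0) \<and>
     (\<forall>a\<in>{-1..1}. horizontal_shear (F_map (-2)) (dilat a) (f_minus2 a)) \<and>
     (\<forall>a\<in>{-1..1}. horizontal_shear (F_map 2) (dilat a) (f_plus2 a)) \<and>
     (\<forall>a\<in>{-1<..1}. f_minus2 a ` \<bbbD> = left_slit_domain (- (2 - a) / 6)) \<and>
     (\<forall>a\<in>{-1..<1}. f_plus2 a ` \<bbbD> = right_slit_domain ((a + 2) / 6)) \<and>
     (\<forall>a\<in>{-1..1}. f_minus2 a \<in> SH0 \<and> f_plus2 a \<in> SH0)"
proof (intro conjI ballI)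
  fix c :: real assume "c \<in> {-2..2}"
  thus "univalent (F_map c)" "horizontally_convex_domain (F_map c ` \<bbbD>)"
    by (rule univalent_F_map, rule horizontally_convex_F_map_image)
next
  fix c a :: real assume c: "c \<in> {-2<..<2}" and a: "a \<in> {-1..1}"
  have c': "c \<in> {-2..2}" using c by simp
  have h0: "h_fun c a 0 = 0"
    using h_fun_eq[OF c, of 0 a] by simp
  note shear = shear_F_mapI[OF c' a has_field_derivative_h_fun[OF c] h0 h_fun_minus_g_fun[OF c]]
  show "horizontal_shear_parts (F_map c) (dilat a) (h_fun c a) (g_fun c a)"
    by (rule shear(1))
  show "f_fun c a \<in> SH0"
    proof (rule shear(2))
    fix z show "f_fun c a z = h_fun c a z + cnj (g_fun c a z)"
      by (simp add: f_fun_def)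
  qed
next
  fix a :: real assume a: "a \<in> {-1..1}"
  show "horizontal_shear (F_map (-2)) (dilat a) (f_minus2 a)" "f_minus2 a \<in> SH0"
    using shear_F_map_boundary[OF _ a f_minus2_eq_shear] by simp_all
  show "horizontal_shear (F_map 2) (dilat a) (f_plus2 a)" "f_plus2 a \<in> SH0"
    using shear_F_map_boundary[OF _ a f_plus2_eq_shear] by simp_all
qed (use f_minus2_image f_plus2_image in auto)

end
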